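(* Let $n\ge 3$ be an integer. The equation $$2\cos\left(\frac{a\pi}{n+1}\right)+2\cos\left(\frac{b\pi}{n+1}\right)=1$$ has a solution with $a,b\in\{1,2,\ldots,n\}$ if and only if $5\mid (n+1)$ or $6\mid (n+1)$. *)

theory Defs
  imports Complex_Main
begin

end

theory Submission
  imports Defs "HOL-Number_Theory.Residues" "HOL-Computational_Algebra.Polynomial"
begin

text \<open>
  Put \<open>N = n + 1\<close>. The equation is an integer polynomial relation for \<open>exp (\<i> \<pi> / N)\<close>, so it
  survives multiplication of \<open>a\<close> and \<open>b\<close> by any \<open>k\<close> coprime to \<open>2N\<close>. As both summands are at most
  \<open>2\<close>, each of them is at least \<open>-1\<close>, for every such \<open>k\<close>. Write \<open>a / (2N) = j / m\<close> in lowest terms: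
  then no fraction with denominator \<open>m\<close> in lowest terms lies strictly between \<open>1/3\<close> and \<open>2/3\<close>, which forces
  \<open>m \<in> {1, 3, 4, 6, 10}\<close>. If \<open>m = 10\<close> occurs for \<open>a\<close> or \<open>b\<close>, then \<open>5\<close> divides \<open>N\<close>; otherwise the
  summands belong to \<open>{-1, 0, 1}\<close>, and their sum is \<open>1\<close> only for \<open>{a, b} = {N/2, N/3}\<close>.
\<close>

section \<open>Evaluating integer polynomials at complex numbers\<close>

text \<open>The ring homomorphism from \<int>[X] to the complex numbers sending X to
  \<open>z\<close>. Coefficients stay integral so that divisibility by a prime and contents keep
  their meaning.\<close>

definition int_poly_eval :: "int poly \<Rightarrow> complex \<Rightarrow> complex" where
  "int_poly_eval p z = poly (map_poly of_int p) z"

lemma int_poly_eval_0 [simp]: "int_poly_eval 0 z = 0"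
  by (simp add: int_poly_eval_def)

lemma int_poly_eval_pCons [simp]:
  "int_poly_eval (pCons a p) z = of_int a + z * int_poly_eval p z"
  by (simp add: int_poly_eval_def map_poly_pCons)

lemma int_poly_eval_1 [simp]: "int_poly_eval 1 z = 1"
  by (simp add: one_pCons)

lemma int_poly_eval_add [simp]:
  "int_poly_eval (p + q) z = int_poly_eval p z + int_poly_eval q z"
proof (induction p arbitrary: q)
  case (pCons a p)
  then show ?case by (cases q) (simp add: algebra_simps)
qed simp

lemma int_poly_eval_smult [simp]:
  "int_poly_eval (smult c p) z = of_int c * int_poly_eval p z"
  by (induction p) (simp_all add: algebra_simps)

lemma int_poly_eval_minus [simp]: "int_poly_eval (- p) z = - int_poly_eval p z"
  using int_poly_eval_smult[of "-1" p z] by simp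

lemma int_poly_eval_diff [simp]:
  "int_poly_eval (p - q) z = int_poly_eval p z - int_poly_eval q z"
  using int_poly_eval_add[of p "- q" z] by simp

lemma int_poly_eval_mult [simp]:
  "int_poly_eval (p * q) z = int_poly_eval p z * int_poly_eval q z"
  by (induction p) (simp_all add: algebra_simps)

lemma int_poly_eval_power [simp]: "int_poly_eval (p ^ n) z = int_poly_eval p z ^ n"
  by (induction n) simp_all

lemma int_poly_eval_monom [simp]: "int_poly_eval (monom c n) z = of_int c * z ^ n"
  by (simp add: int_poly_eval_def map_poly_monom poly_monom)

lemma int_poly_eval_pcompose:
  "int_poly_eval (pcompose p q) z = int_poly_eval p (int_poly_eval q z)"
  by (induction p) (simp_all add: pcompose_pCons)

section \<open>The Frobenius congruence\<close>

text \<open>The inner binomial coefficients are multiples of \<open>p\<close>. A general commutative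
  ring is allowed because the use below is in \<open>int poly\<close>.\<close>

lemma prime_dvd_power_add_diff:
  fixes x y :: "'a :: comm_ring_1"
  assumes "prime p"
  shows "of_nat p dvd (x + y) ^ p - (x ^ p + y ^ p)"
proof -
  have p: "p > 0" using assms prime_gt_0_nat by blast
  have "(x + y) ^ p = (\<Sum>k\<le>p. of_nat (p choose k) * x ^ k * y ^ (p - k))"
    by (rule binomial_ring)
  also have "{..p} = insert 0 (insert p {0<..<p})" using p by auto
  also have "(\<Sum>k\<in>\<dots>. of_nat (p choose k) * x ^ k * y ^ (p - k)) =
      x ^ p + y ^ p + (\<Sum>k\<in>{0<..<p}. of_nat (p choose k) * x ^ k * y ^ (p - k))"
    using p by (simp add: algebra_simps)
  finally have "(x + y) ^ p - (x ^ p + y ^ p) =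
      (\<Sum>k\<in>{0<..<p}. of_nat (p choose k) * x ^ k * y ^ (p - k))"
    by (simp add: algebra_simps)
  also have "of_nat p dvd \<dots>"
  proof (rule dvd_sum)
    fix k assume "k \<in> {0<..<p}"
    then have "p dvd p choose k" using assms by (intro dvd_choose_prime) auto
    then obtain c where c: "p choose k = p * c" by (elim dvdE)
    show "(of_nat p :: 'a) dvd of_nat (p choose k) * x ^ k * y ^ (p - k)"
      by (simp add: c mult.assoc)
  qed
  finally show ?thesis .
qed

text \<open>Fermat's little theorem, carried over from the natural residue \<open>b\<close> of
  \<open>a\<close>.\<close>

lemma prime_dvd_power_diff_int:
  fixes a :: int
  assumes "prime p"
  shows "int p dvd a ^ p - a"
proof -
  have p: "p > 0" using assms prime_gt_0_nat by blast
  define b where "b = nat (a mod int p)"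
  have b: "int b = a mod int p" using p by (simp add: b_def)
  have "[b ^ p = b] (mod p)"
  proof (cases "p dvd b")
    case True
    then show ?thesis using p
      by (metis cong_0_iff cong_def dvd_power dvd_trans)
  next
    case False
    then have "[b * b ^ (p - 1) = b * 1] (mod p)"
      by (intro cong_mult cong_refl fermat_theorem assms)
    then show ?thesis using p by (simp flip: power_Suc)
  qed
  then have "[int b ^ p = int b] (mod int p)"
    by (metis cong_int_iff of_nat_power)
  then have "[a ^ p = a] (mod int p)"
    unfolding b by (simp add: cong_def power_mod)
  then show ?thesis by (simp add: cong_iff_dvd_diff)
qed

text \<open>Modulo \<open>p\<close>, raising to the power \<open>p\<close> is additive and fixes the
  coefficients, so h(X)^p agrees with h(X^p). The induction splits off the constant
  coefficient.\<close>

lemma prime_dvd_pcompose_monom_diff_power: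
  fixes h :: "int poly"
  assumes "prime p"
  shows "of_nat p dvd pcompose h (monom 1 p) - h ^ p"
proof (induction h)
  case 0
  have "p > 0" using assms prime_gt_0_nat by blast
  then show ?case by (simp add: power_0_left)
next
  case (pCons a h)
  define X :: "int poly" where "X = [:0, 1:]"
  let ?p = "of_nat p :: int poly"
  have m: "monom 1 p = X ^ p" by (simp add: X_def monom_altdef)
  have e: "pCons a h = [:a:] + X * h" by (simp add: X_def)
  have 1: "?p dvd ([:a:] + X * h) ^ p - ([:a:] ^ p + (X * h) ^ p)"
    by (rule prime_dvd_power_add_diff[OF assms])
  obtain c where c: "a ^ p - a = int p * c"
    using prime_dvd_power_diff_int[OF assms, of a] by (elim dvdE)
  have "[:a:] ^ p - [:a:] = [:int p * c:]"
    by (simp add: poly_const_pow flip: c)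
  also have "\<dots> = ?p * [:c:]" by (simp add: of_nat_poly)
  finally have 2: "?p dvd [:a:] ^ p - [:a:]" by (metis dvd_triv_left)
  have 3: "?p dvd X ^ p * (pcompose h (monom 1 p) - h ^ p)"
    using pCons.IH by (rule dvd_mult)
  have "pcompose (pCons a h) (monom 1 p) - pCons a h ^ p =
      X ^ p * (pcompose h (monom 1 p) - h ^ p) - ([:a:] ^ p - [:a:])
      - (([:a:] + X * h) ^ p - ([:a:] ^ p + (X * h) ^ p))"
    unfolding pcompose_pCons m by (subst e) (simp add: algebra_simps power_mult_distrib)
  then show ?case by (rule ssubst) (intro dvd_diff 1 2 3)
qed

section \<open>Conjugation of roots of unity\<close>

text \<open>Take the primitive part of an annihilating polynomial of least degree. Pseudo-division
  leaves remainder zero by minimality, and Gauss's lemma on contents removes the scaling factor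
  \<open>c\<close>.\<close>

lemma minimal_int_poly_exists:
  assumes "q \<noteq> 0" "int_poly_eval q z = 0"
  obtains f where "f \<noteq> 0" "int_poly_eval f z = 0"
    "\<And>g. int_poly_eval g z = 0 \<Longrightarrow> f dvd g"
    "\<And>g. int_poly_eval g z = 0 \<Longrightarrow> degree g < degree f \<Longrightarrow> g = 0"
proof -
  let ?S = "\<lambda>g. g \<noteq> 0 \<and> int_poly_eval g z = 0"
  obtain g where g: "?S g" and min: "\<And>g'. ?S g' \<Longrightarrow> degree g \<le> degree g'"
    using assms ex_has_least_nat[of ?S q degree] by blast
  define f where "f = primitive_part g"
  have f0: "f \<noteq> 0" and fc: "content f = 1" and fd: "degree f = degree g"
    using g by (auto simp: f_def)
  have "of_int (content g) * int_poly_eval f z = 0"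
    using g int_poly_eval_smult[of "content g" f z] by (simp add: f_def)
  then have fz: "int_poly_eval f z = 0" using g by auto
  have small: "r = 0" if "int_poly_eval r z = 0" "degree r < degree f" for r
    using min[of r] that fd by fastforce
  have dvd: "f dvd P" if P: "int_poly_eval P z = 0" for P
  proof -
    obtain s r where sr: "pseudo_divmod P f = (s, r)" by fastforce
    define c where "c = coeff f (degree f) ^ (Suc (degree P) - degree f)"
    have c0: "c \<noteq> 0" using f0 by (simp add: c_def)
    have eq: "smult c P = f * s + r" and "r = 0 \<or> degree r < degree f"
      using pseudo_divmod[OF f0 sr] by (auto simp: c_def)
    moreover have "int_poly_eval r z = 0"
      using arg_cong[OF eq, of "\<lambda>p. int_poly_eval p z"] P fz by simp
    ultimately have "r = 0" using small by blast
    with eq have eq: "smult c P = f * s" by simp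
    then have "content (smult c P) = content s" by (simp add: content_mult fc)
    then have "content s = \<bar>c\<bar> * content P" by simp
    then have "c dvd content s" by simp
    then have "[:c:] dvd s" by (simp add: const_poly_dvd_iff_dvd_content)
    then obtain t where "s = smult c t" by (auto elim: dvdE)
    with eq have "smult c (P - f * t) = 0" by (simp add: smult_diff_right)
    with c0 have "P = f * t" by simp
    then show ?thesis by simp
  qed
  show ?thesis using that f0 fz dvd small by blast
qed

text \<open>Dedekind's argument. If \<open>h(z\<^sup>p) = 0\<close> for the cofactor \<open>h\<close> of the minimal polynomial \<open>f\<close>,
  then \<open>h(z)\<^sup>p\<close> is divisible by \<open>p\<close> in \<open>\<int>[z]\<close>; but \<open>h(z)\<close> divides \<open>M\<close> there, as one sees by
  differentiating \<open>X\<^sup>M - 1 = f h\<close>. So \<open>p\<close> would divide \<open>M\<^sup>p\<close>.\<close>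
lemma root_of_unity_conjugate_prime:
  assumes z: "z ^ M = 1" and M: "M > 0" and p: "prime p" "\<not> p dvd M"
    and P: "int_poly_eval P z = 0"
  shows "int_poly_eval P (z ^ p) = 0"
proof -
  let ?q = "monom 1 M - 1 :: int poly"
  have q0: "?q \<noteq> 0" using M
    by (metis degree_1 degree_monom_eq eq_iff_diff_eq_0 not_gr_zero one_neq_zero)
  have qz: "int_poly_eval ?q z = 0" using z by simp
  obtain f where f: "f \<noteq> 0" "int_poly_eval f z = 0"
    "\<And>g. int_poly_eval g z = 0 \<Longrightarrow> f dvd g"
    "\<And>g. int_poly_eval g z = 0 \<Longrightarrow> degree g < degree f \<Longrightarrow> g = 0"
    using minimal_int_poly_exists[OF q0 qz] by blast
  from f(3)[OF qz] obtain h where h: "?q = f * h" by (elim dvdE)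
  \<comment> \<open>As a divisor of a monic polynomial, \<open>f\<close> has a unit as leading
    coefficient, so pseudo-division by \<open>f\<close> will scale only by a unit.\<close>
  have lc: "lead_coeff f dvd 1"
  proof -
    have "degree (monom (1 :: int) M + - 1) = degree (monom (1 :: int) M)"
      by (rule degree_add_eq_left) (use M in \<open>simp add: degree_monom_eq\<close>)
    then have "degree ?q = M" by (simp add: degree_monom_eq)
    then have "lead_coeff ?q = 1" using M by simp
    then have "lead_coeff f * lead_coeff h = 1" unfolding h lead_coeff_mult .
    then show ?thesis by (rule dvdI[OF sym])
  qed
  have fp: "int_poly_eval f (z ^ p) = 0"
  proof (rule ccontr)
    assume nz: "int_poly_eval f (z ^ p) \<noteq> 0"
    have "(z ^ p) ^ M = 1" using z by (metis mult.commute power_mult power_one)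
    then have "int_poly_eval f (z ^ p) * int_poly_eval h (z ^ p) = 0"
      using arg_cong[OF h, of "\<lambda>q. int_poly_eval q (z ^ p)"] by simp
    with nz have hp: "int_poly_eval h (z ^ p) = 0" by simp
    obtain s where s: "pcompose h (monom 1 p) - h ^ p = of_nat p * s"
      using prime_dvd_pcompose_monom_diff_power[OF p(1), of h] by (elim dvdE)
    have hz: "- (int_poly_eval h z ^ p) = of_nat p * int_poly_eval s z"
      using arg_cong[OF s, of "\<lambda>q. int_poly_eval q z"] hp
      by (simp add: int_poly_eval_pcompose of_nat_poly)
    have "pderiv ?q = smult (int M) (monom 1 (M - 1))"
      by (simp add: pderiv_diff pderiv_monom smult_monom)
    moreover have "pderiv ?q = pderiv f * h + f * pderiv h"
      unfolding h by (simp add: pderiv_mult algebra_simps)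
    ultimately have deriv: "smult (int M) (monom 1 (M - 1)) = pderiv f * h + f * pderiv h"
      by (rule trans[OF sym])
    have "z * (of_nat M * z ^ (M - 1)) = z * int_poly_eval (pderiv f) z * int_poly_eval h z"
      using arg_cong[OF deriv, of "\<lambda>q. int_poly_eval q z"] f(2) by simp
    also have "z * (of_nat M * z ^ (M - 1)) = of_nat M * z ^ Suc (M - 1)" by simp
    also have "\<dots> = of_nat M" using z M by simp
    finally have Mz: "of_nat M = z * int_poly_eval (pderiv f) z * int_poly_eval h z" .
    define t where "t = - (([:0, 1:] * pderiv f) ^ p * s)"
    have t: "of_nat M ^ p = of_nat p * int_poly_eval t z"
    proof -
      have "of_nat M ^ p = - ((z * int_poly_eval (pderiv f) z) ^ p) * (- (int_poly_eval h z ^ p))"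
        by (simp add: Mz power_mult_distrib)
      then show ?thesis unfolding hz by (simp add: t_def)
    qed
    obtain s' r where sr: "pseudo_divmod t f = (s', r)" by fastforce
    define c where "c = coeff f (degree f) ^ (Suc (degree t) - degree f)"
    have c: "c dvd 1" using lc unfolding c_def by (metis dvd_power_same power_one)
    have eq: "smult c t = f * s' + r" and r: "r = 0 \<or> degree r < degree f"
      using pseudo_divmod[OF f(1) sr] by (auto simp: c_def)
    have cr: "of_int c * int_poly_eval t z = int_poly_eval r z"
      using arg_cong[OF eq, of "\<lambda>p. int_poly_eval p z"] f(2) by simp
    have df: "degree f > 0"
    proof (rule ccontr)
      assume "\<not> 0 < degree f"
      then obtain a where "f = [:a:]" using degree_eq_zeroE by blast
      then show False using f(1,2) by simp
    qed
    \<comment> \<open>\<open>r\<close> represents \<open>c\<close> times \<open>t\<close> in degree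
      below that of \<open>f\<close>. Hence \<open>g\<close> vanishes at \<open>z\<close> by the
      choice of \<open>t\<close>, minimality makes it the zero polynomial, and its constant
      coefficient turns divisibility in \<int>[z] into divisibility in \<int>.\<close>
    define g where "g = [:c * int M ^ p:] - smult (int p) r"
    have "int_poly_eval g z = 0" unfolding g_def using cr t by simp
    moreover have "degree g < degree f"
      unfolding g_def using r df by (intro degree_diff_less) auto
    ultimately have "g = 0" by (rule f(4))
    then have "coeff [:c * int M ^ p:] 0 = coeff (smult (int p) r) 0" by (simp add: g_def)
    then have "int p dvd c * int M ^ p" by simp
    then have "int p dvd int M ^ p" using c
      by (metis dvd_mult_unit_iff' dvd_trans mult.commute mult_dvd_mono mult_1 dvd_refl)
    then have "p dvd M ^ p" by (metis of_nat_dvd_iff of_nat_power)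
    then show False using p prime_dvd_power by blast
  qed
  from f(3)[OF P] obtain u where "P = f * u" by (elim dvdE)
  with fp show ?thesis by simp
qed

text \<open>Apply the prime case once for each prime factor of \<open>k\<close>; every intermediate
  power of \<open>z\<close> is again an \<open>M\<close>-th root of unity.\<close>

lemma root_of_unity_conjugate:
  assumes "z ^ M = 1" "M > 0" "k > 0" "coprime k M" "int_poly_eval P z = 0"
  shows "int_poly_eval P (z ^ k) = 0"
  using assms
proof (induction k arbitrary: z rule: prime_divisors_induct)
  case (factor p k)
  have "\<not> p dvd M"
    using factor.prems(4) factor.hyps
    by (metis coprime_common_divisor dvd_triv_left not_prime_unit)
  then have "int_poly_eval P (z ^ p) = 0"
    using factor root_of_unity_conjugate_prime by blast
  moreover have "(z ^ p) ^ M = 1" using factor.prems(1)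
    by (metis mult.commute power_mult power_one)
  ultimately have "int_poly_eval P ((z ^ p) ^ k) = 0"
    using factor by (intro factor.IH) auto
  then show ?case by (simp add: power_mult)
qed auto

section \<open>Conjugating the cosine equation\<close>

lemma cos_sum_conjugate:
  fixes a b k N :: nat
  assumes N: "N > 0" and a: "a \<le> N" and b: "b \<le> N" and k: "k > 0" "coprime k (2 * N)"
    and eq: "2 * cos (real a * pi / real N) + 2 * cos (real b * pi / real N) = 1"
  shows "2 * cos (real (k * a) * pi / real N) + 2 * cos (real (k * b) * pi / real N) = 1"
proof -
  define z where "z = cis (pi / real N)"
  \<comment> \<open>The exponents \<open>2 * N - a\<close> and \<open>2 * N - b\<close> stand for
    \<open>- a\<close> and \<open>- b\<close>, so that Euler's formula for the cosines gives a
    genuine polynomial in \<open>z\<close>.\<close>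
  define P :: "int poly" where
    "P = monom 1 a + monom 1 (2 * N - a) + monom 1 b + monom 1 (2 * N - b) - 1"
  have z: "z ^ (2 * N) = 1" unfolding z_def using N by (simp add: Complex.DeMoivre)
  have pw: "z ^ (l * c) + z ^ (l * (2 * N - c)) = of_real (2 * cos (real (l * c) * pi / real N))"
    if "c \<le> N" for l c
  proof -
    have "l * c + l * (2 * N - c) = l * (2 * N)" using that by (simp flip: distrib_left)
    then have "z ^ (l * c) * z ^ (l * (2 * N - c)) = z ^ (l * (2 * N))"
      by (metis power_add)
    also have "\<dots> = 1" using z by (metis mult.commute power_mult power_one)
    finally have "z ^ (l * (2 * N - c)) = inverse (z ^ (l * c))"
      by (metis inverse_unique)
    also have "\<dots> = cis (- (real (l * c) * pi / real N))"
      by (simp add: z_def Complex.DeMoivre cis_inverse)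
    finally show ?thesis
      by (simp add: z_def Complex.DeMoivre complex_eq_iff)
  qed
  have ev: "int_poly_eval P (z ^ l) = of_real (2 * cos (real (l * a) * pi / real N)
      + 2 * cos (real (l * b) * pi / real N) - 1)" for l
    using pw[OF a, of l] pw[OF b, of l] by (simp add: P_def flip: power_mult)
  have "int_poly_eval P (z ^ 1) = 0" unfolding ev using eq by simp
  then have "int_poly_eval P (z ^ k) = 0"
    using root_of_unity_conjugate[OF z] N k by simp
  then have "2 * cos (real (k * a) * pi / real N) + 2 * cos (real (k * b) * pi / real N) - 1 = 0"
    unfolding ev of_real_eq_0_iff .
  then show ?thesis by simp
qed

section \<open>Lifting units and reaching the middle third of the circle\<close>

text \<open>Units modulo \<open>m\<close> lift to units modulo \<open>L\<close>: add to
  \<open>k\<close> the product of \<open>m\<close> and the primes of \<open>L\<close> that do not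
  divide \<open>k\<close>. Each prime divisor of \<open>L\<close> then divides exactly one of the
  two summands.\<close>

lemma coprime_lift:
  fixes k m L :: nat
  assumes "coprime k m" "L > 0" "m > 0"
  obtains k' where "k' > 0" "coprime k' L" "[k' = k] (mod m)"
proof -
  define S where "S = {q. prime q \<and> q dvd L \<and> \<not> q dvd k}"
  have fin: "finite S" unfolding S_def using assms(2)
    by (auto intro: finite_subset[OF _ finite_divisors_nat])
  define k' where "k' = k + m * \<Prod>S"
  have "\<Prod>S > 0" by (rule prod_pos) (auto simp: S_def prime_gt_0_nat)
  then have "k' > 0" using assms(3) by (simp add: k'_def)
  moreover have "coprime k' L"
  proof (rule ccontr)
    assume "\<not> coprime k' L"
    then have "gcd k' L \<noteq> 1" by (simp add: coprime_iff_gcd_eq_1)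
    then obtain q where "prime q" "q dvd gcd k' L" using prime_factor_nat by blast
    then have q: "prime q" "q dvd k'" "q dvd L" by simp_all
    show False
    proof (cases "q dvd k")
      case True
      then have "q dvd m * \<Prod>S" using q(2) by (simp add: k'_def dvd_add_right_iff)
      moreover have "\<not> q dvd m"
        using True assms(1) q(1) by (metis coprime_common_divisor not_prime_unit)
      ultimately have "q dvd \<Prod>S" using q(1) prime_dvd_mult_iff by blast
      then obtain r where "r \<in> S" "q dvd r"
        using prime_dvd_prod_iff[OF fin q(1), of "\<lambda>x. x"] by auto
      then show False using q(1) True primes_dvd_imp_eq by (auto simp: S_def)
    next
      case False
      then have "q dvd m * \<Prod>S" using q fin by (intro dvd_mult dvd_prodI[of S q "\<lambda>x. x", simplified]) (auto simp: S_def)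
      then show False using False q(2) by (simp add: k'_def dvd_add_left_iff)
    qed
  qed
  moreover have "[k' = k] (mod m)" by (simp add: k'_def cong_def)
  ultimately show ?thesis using that by blast
qed

text \<open>The fraction is \<open>1/2\<close> or the reduced fraction just below it that is closest to it.\<close>
lemma coprime_middle_third:
  fixes m :: nat
  assumes "m > 0" "m \<notin> {1, 3, 4, 6, 10}"
  obtains k where "coprime k m" "m < 3 * k" "3 * k < 2 * m"
proof (cases "m = 2")
  case True
  then show ?thesis using that[of 1] by simp
next
  case False
  have cop: "coprime k m" if "\<And>d. d dvd k \<Longrightarrow> d dvd m \<Longrightarrow> d = 1" for k
    using that by (intro coprimeI) simp
  have "m = 2 * (m div 2) + 1 \<or> m = 4 * (m div 4) \<or> m = 4 * (m div 4) + 2"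
    by presburger
  \<comment> \<open>In the three cases \<open>m < 3 * k\<close> amounts to l > 1, l > 1 and l > 2.
    It fails only for the excluded values of \<open>m\<close> and for \<open>m = 2\<close>, treated
    above.\<close>
  then consider l where "m = 2 * l + 1" | l where "m = 4 * l" | l where "m = 4 * l + 2"
    by blast
  then show ?thesis
  proof cases
    case 1
    have "coprime l m"
    proof (rule cop)
      fix d assume d: "d dvd l" "d dvd m"
      then have "d dvd 2 * l + 1" "d dvd 2 * l" using 1 by simp_all
      then have "d dvd 1" by (metis dvd_add_right_iff)
      then show "d = 1" by simp
    qed
    then show ?thesis using that[of l] 1 assms by auto
  next
    case 2
    have "coprime (2 * l - 1) m"
    proof (rule cop)
      fix d assume d: "d dvd 2 * l - 1" "d dvd m"
      have l: "l > 0" using 2 assms by auto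
      then have "2 * (2 * l - 1) + 2 = m" using 2 by simp
      then have "d dvd 2" using d by (metis dvd_add_right_iff dvd_mult)
      moreover have "odd d" using d(1) l by (auto dest: dvd_trans)
      moreover have "d = 0 \<or> d = 1 \<or> d = 2" using \<open>d dvd 2\<close> dvd_imp_le[of d 2] by auto
      ultimately show "d = 1" by auto
    qed
    then show ?thesis using that[of "2 * l - 1"] 2 assms by auto
  next
    case 3
    have "coprime (2 * l - 1) m"
    proof (rule cop)
      fix d assume d: "d dvd 2 * l - 1" "d dvd m"
      have l: "l > 0" using 3 assms False by (cases l) auto
      then have "2 * (2 * l - 1) + 4 = m" using 3 by simp
      then have "d dvd 4" using d by (metis dvd_add_right_iff dvd_mult)
      moreover have "odd d" using d(1) l by (auto dest: dvd_trans)
      moreover have "d = 0 \<or> d = 1 \<or> d = 2 \<or> d = 3 \<or> d = 4" using \<open>d dvd 4\<close> dvd_imp_le[of d 4] by auto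
      ultimately show "d = 1" by auto
    qed
    then show ?thesis using that[of "2 * l - 1"] 3 assms False by auto
  qed
qed

lemma cos_middle_third:
  fixes k m :: nat
  assumes "m < 3 * k" "3 * k < 2 * m"
  shows "cos (2 * pi * real k / real m) < - 1 / 2"
proof -
  \<comment> \<open>Measured from pi, the angle is less than pi / 3 in absolute value, where cosine
    exceeds 1/2.\<close>
  define t where "t = 2 * pi * real k / real m - pi"
  have m: "real m > 0" using assms by simp
  have "real m < 3 * real k" "3 * real k < 2 * real m" using assms by linarith+
  then have "2 * real k / real m - 1 < 1 / 3" "- (1 / 3) < 2 * real k / real m - 1"
    using m by (simp_all add: field_simps)
  then have "\<bar>2 * real k / real m - 1\<bar> < 1 / 3" by linarith
  then have "pi * \<bar>2 * real k / real m - 1\<bar> < pi * (1 / 3)"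
    by (intro mult_strict_left_mono pi_gt_zero)
  moreover have "t = pi * (2 * real k / real m - 1)" by (simp add: t_def algebra_simps)
  ultimately have "\<bar>t\<bar> < pi / 3" by (simp add: abs_mult)
  then have "cos (pi / 3) < cos \<bar>t\<bar>" by (intro cos_monotone_0_pi) auto
  also have "cos \<bar>t\<bar> = - cos (2 * pi * real k / real m)"
    by (simp add: t_def cos_diff)
  finally show ?thesis by (simp add: cos_60)
qed

lemma cos_cong:
  fixes x y N :: nat
  assumes "[x = y] (mod 2 * N)" "N > 0"
  shows "cos (real x * pi / real N) = cos (real y * pi / real N)"
proof -
  obtain q where q: "int x - int y = int (2 * N) * q"
    using assms(1) by (metis cong_iff_dvd_diff cong_int_iff dvdE)
  then have "real x = real y + 2 * real N * of_int q"
    by (metis (no_types) add.commute diff_add_cancel of_int_add of_int_mult of_int_of_nat_eq of_nat_mult of_nat_numeral)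
  then have "real x * pi / real N = real y * pi / real N + 2 * pi * of_int q"
    using assms(2) by (simp add: field_simps)
  then show ?thesis by (simp only: cos_add cos_int_2pin sin_int_2pin)
qed

section \<open>Possible denominators of the angles\<close>

text \<open>The conclusion restricts \<open>a\<close> alone; swapping the summands gives the same
  for \<open>b\<close>.\<close>

lemma cos_sum_cases:
  fixes a b N :: nat
  assumes a: "0 < a" "a < N" and b: "0 < b" "b < N"
    and eq: "2 * cos (real a * pi / real N) + 2 * cos (real b * pi / real N) = 1"
  shows "5 dvd N \<or> (3 * a = 2 * N) \<or> (2 * a = N) \<or> (3 * a = N)"
proof -
  define g where "g = gcd a (2 * N)"
  have g: "g > 0" using a by (simp add: g_def)
  obtain j m where jm: "a = j * g" "2 * N = m * g" "coprime j m"
    using gcd_coprime_exists[of a "2 * N"] g unfolding g_def by auto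
  have m: "m > 0" using jm(2) a by (cases m) auto
  have "2 * j * g < m * g" using jm a by linarith
  then have j: "0 < j" "2 * j < m" using jm(1) a by auto
  have "m \<in> {1, 3, 4, 6, 10}"
  proof (rule ccontr)
    assume "m \<notin> {1, 3, 4, 6, 10}"
    then obtain k0 where k0: "coprime k0 m" "m < 3 * k0" "3 * k0 < 2 * m"
      using coprime_middle_third[OF m] by blast
    \<comment> \<open>With \<open>i\<close> inverse to \<open>j\<close> modulo \<open>m\<close>, a
      multiplier congruent to \<open>k0 * i\<close> moves the fraction j/m to k0/m modulo 1. The
      lift makes it coprime to \<open>2 * N\<close> as well, as conjugation requires.\<close>
    obtain i where i: "[j * i = 1] (mod m)"
      using cong_solve_coprime_nat[OF jm(3)] by auto
    then have "coprime i m"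
      by (metis coprime_cong_cong_left coprime_1_left coprime_mult_left_iff)
    then have "coprime (k0 * i) m" using k0(1) by simp
    then obtain k where k: "k > 0" "coprime k (2 * N)" "[k = k0 * i] (mod m)"
      using coprime_lift[of "k0 * i" m "2 * N"] m a by auto
    have "[k * j = k0 * i * j] (mod m)" using k(3) by (intro cong_mult cong_refl)
    also have "k0 * i * j = k0 * (j * i)" by simp
    also have "[\<dots> = k0 * 1] (mod m)" using i by (intro cong_mult cong_refl)
    finally have "[k * j = k0] (mod m)" by simp
    then have "[k * j * g = k0 * g] (mod (m * g))"
      using g by (simp add: cong_def mod_mult_mult2)
    then have "[k * a = k0 * g] (mod (2 * N))" using jm by (simp add: mult.assoc)
    then have "cos (real (k * a) * pi / real N) = cos (real (k0 * g) * pi / real N)"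
      by (rule cos_cong) (use a in simp)
    also have "real (k0 * g) * pi / real N = 2 * pi * real k0 / real m"
    proof -
      have "2 * real N = real m * real g" using jm(2) by (metis of_nat_mult of_nat_numeral)
      then show ?thesis using m g a by (simp add: field_simps)
    qed
    finally have "cos (real (k * a) * pi / real N) < - 1 / 2"
      using cos_middle_third[OF k0(2,3)] by simp
    moreover have "2 * cos (real (k * a) * pi / real N) + 2 * cos (real (k * b) * pi / real N) = 1"
      using cos_sum_conjugate[of N a b k] a b k eq by simp
    moreover have "cos (real (k * b) * pi / real N) \<le> 1" by simp
    ultimately show False by linarith
  qed
  then consider "m = 1" | "m = 3" | "m = 4" | "m = 6" | "m = 10" by auto
  then show ?thesis
  proof cases
    case 1
    then show ?thesis using j by simp
  next
    case 2
    then have "j = 1" using j by simp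
    then show ?thesis using jm 2 by simp
  next
    case 3
    then have "j = 1" using j by simp
    then show ?thesis using jm 3 by simp
  next
    case 4
    then have "j = 1 \<or> j = 2" using j by auto
    moreover have "j \<noteq> 2" using jm(3) 4 by auto
    ultimately have "j = 1" by simp
    then show ?thesis using jm 4 by simp
  next
    case 5
    then have "N = 5 * g" using jm by simp
    then show ?thesis by simp
  qed
qed

section \<open>Special cosine values and the equivalence\<close>

lemma cos_special:
  fixes a N :: nat
  assumes "N > 0"
  shows "3 * a = 2 * N \<Longrightarrow> cos (real a * pi / real N) = - 1 / 2"
    and "2 * a = N \<Longrightarrow> cos (real a * pi / real N) = 0"
    and "3 * a = N \<Longrightarrow> cos (real a * pi / real N) = 1 / 2"
proof -
  assume "3 * a = 2 * N"
  then have "3 * real a = 2 * real N" by linarith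
  then have e: "real a * pi / real N = 2 * pi / 3" using assms by (simp add: field_simps)
  show "cos (real a * pi / real N) = - 1 / 2" unfolding e by (simp add: cos_120)
next
  assume "2 * a = N"
  then have "2 * real a = real N" by linarith
  then have e: "real a * pi / real N = pi / 2" using assms by (simp add: field_simps)
  show "cos (real a * pi / real N) = 0" unfolding e by simp
next
  assume "3 * a = N"
  then have "3 * real a = real N" by linarith
  then have e: "real a * pi / real N = pi / 3" using assms by (simp add: field_simps)
  show "cos (real a * pi / real N) = 1 / 2" unfolding e by (simp add: cos_60)
qed

text \<open>Multiplying by sin(pi/5) makes the sum telescope to sin(4 pi/5), which equals
  sin(pi/5).\<close>

lemma cos_fifths: "2 * cos (pi / 5) + 2 * cos (3 * pi / 5) = (1 :: real)"
proof -
  have s: "sin (pi / 5) \<noteq> 0" using sin_gt_zero[of "pi / 5"] pi_gt_zero by simp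
  have "2 * sin (pi / 5) * cos (pi / 5) = sin (2 * pi / 5)"
    using sin_double[of "pi / 5"] by simp
  moreover have "2 * sin (pi / 5) * cos (3 * pi / 5) = sin (4 * pi / 5) - sin (2 * pi / 5)"
    using sin_add[of "3 * pi / 5" "pi / 5"] sin_diff[of "3 * pi / 5" "pi / 5"] by simp
  moreover have "sin (4 * pi / 5) = sin (pi / 5)"
    using sin_pi_minus[of "pi / 5"] by simp
  ultimately have "sin (pi / 5) * (2 * cos (pi / 5) + 2 * cos (3 * pi / 5)) = sin (pi / 5) * 1"
    by (simp add: algebra_simps)
  then show ?thesis using s by (metis mult_left_cancel)
qed

theorem theorem20:
  fixes n :: nat
  assumes "n \<ge> 3"
  shows "(\<exists>a\<in>{1..n}. \<exists>b\<in>{1..n}.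
            2 * cos (real a * pi / real (n + 1)) + 2 * cos (real b * pi / real (n + 1)) = 1)
         \<longleftrightarrow> 5 dvd (n + 1) \<or> 6 dvd (n + 1)"
proof
  assume "\<exists>a\<in>{1..n}. \<exists>b\<in>{1..n}.
      2 * cos (real a * pi / real (n + 1)) + 2 * cos (real b * pi / real (n + 1)) = 1"
  then obtain a b where "a \<in> {1..n}" "b \<in> {1..n}"
    and eq: "2 * cos (real a * pi / real (n + 1)) + 2 * cos (real b * pi / real (n + 1)) = 1"
    by blast
  then have a: "0 < a" "a < n + 1" and b: "0 < b" "b < n + 1" by simp_all
  define N where "N = n + 1"
  have N: "N > 0" by (simp add: N_def)
  note ab = a[folded N_def] b[folded N_def]
  note eq' = eq[folded N_def]
  have eq2: "2 * cos (real b * pi / real N) + 2 * cos (real a * pi / real N) = 1"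
    using eq' by simp
  consider "5 dvd N"
    | "3 * a = 2 * N \<or> 2 * a = N \<or> 3 * a = N" "3 * b = 2 * N \<or> 2 * b = N \<or> 3 * b = N"
    using cos_sum_cases[OF ab eq'] cos_sum_cases[OF ab(3,4,1,2) eq2] by blast
  then have "5 dvd N \<or> 6 dvd N"
  proof cases
    case 2
    then have "2 * a = N \<and> 3 * b = N \<or> 3 * a = N \<and> 2 * b = N"
      using eq' cos_special[OF N, of a] cos_special[OF N, of b] by auto
    \<comment> \<open>The difference of N/2 and N/3 is N/6; the two alternatives account for which
      of \<open>a\<close> and \<open>b\<close> is larger, as subtraction truncates.\<close>
    then have "N = 6 * (a - b) \<or> N = 6 * (b - a)" by linarith
    then show ?thesis by (metis dvd_triv_left)
  qed simp
  then show "5 dvd (n + 1) \<or> 6 dvd (n + 1)" by (simp add: N_def)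
next
  assume "5 dvd (n + 1) \<or> 6 dvd (n + 1)"
  then show "\<exists>a\<in>{1..n}. \<exists>b\<in>{1..n}.
      2 * cos (real a * pi / real (n + 1)) + 2 * cos (real b * pi / real (n + 1)) = 1"
  proof
    assume "5 dvd (n + 1)"
    then obtain c where c: "n + 1 = 5 * c" by (elim dvdE)
    then have c0: "c > 0" by (cases c) auto
    have e: "real c * pi / real (n + 1) = pi / 5" "real (3 * c) * pi / real (n + 1) = 3 * pi / 5"
      unfolding c using c0 by (simp_all add: field_simps)
    have "2 * cos (real c * pi / real (n + 1)) + 2 * cos (real (3 * c) * pi / real (n + 1)) = 1"
      unfolding e by (rule cos_fifths)
    moreover have "c \<in> {1..n}" "3 * c \<in> {1..n}" using c c0 by auto
    ultimately show ?thesis by blast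
  next
    assume "6 dvd (n + 1)"
    then obtain c where c: "n + 1 = 6 * c" by (elim dvdE)
    then have c0: "c > 0" by (cases c) auto
    have "cos (real (2 * c) * pi / real (n + 1)) = 1 / 2"
      "cos (real (3 * c) * pi / real (n + 1)) = 0"
      by (rule cos_special; use c in simp)+
    then have "2 * cos (real (2 * c) * pi / real (n + 1)) + 2 * cos (real (3 * c) * pi / real (n + 1)) = 1"
      by simp
    moreover have "2 * c \<in> {1..n}" "3 * c \<in> {1..n}" using c c0 by auto
    ultimately show ?thesis by blast
  qed
qed

end
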